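(* Let $(\mathbb{X},\perp)$ be a $\perp$-restriction category, and let $f:X\to X$ and $g:X\to A$ be maps with $f\perp g$. Then for all $n,m\in\mathbb{N}$ with $n\ne m$, $f^ng\perp f^mg$ (where $f^0=1_X$). Furthermore, if $(\mathbb{X},\circledast)$ is a $\perp$-itegory, then for all $n\in\mathbb{N}$, $$f\circledast g=g\sqcup fg\sqcup f^2g\sqcup\dots\sqcup f^ng\sqcup f^{n+1}(f\circledast g),$$ i.e. $f\circledast g$ is the $\perp$-join of the family $\{g,fg,\dots,f^ng,f^{n+1}(f\circledast g)\}$. In particular, $f^ng\le f\circledast g$ for all $n\in\mathbb{N}$.
   Context: Composition is diagrammatic: $fg$ means first $f$, then $g$. A restriction category is a category with an operator sending each $f:A\to B$ to $\overline{f}:A\to A$ such that $\overline{f}f=f$; $\overline{f}\,\overline{g}=\overline{g}\,\overline{f}$ and $\overline{\overline{g}f}=\overline{g}\,\overline{f}$ for $f:A\to B$, $g:A\to C$; and $f\overline{g}=\overline{fg}f$ for $f:A\to B$, $g:B\to C$. For parallel $f,g$: $f\le g$ iff $\overline{f}g=f$ (a partial order). Restriction zeroes: maps $0:A\to B$ with $f0=0=0f$ and $\overline{0}=0$. An interference relation $\perp$ on a restriction category with restriction zeroes is a family of relations between maps with the same domain such that: $1_A\perp 0$; $f\perp g\Rightarrow g\perp f$; $f\perp f\Rightarrow f=0$; $f'\perp g'$, $f\le f'$, $g\le g'$ imply $f\perp g$; $f\perp g\Rightarrow hfk\perp hgk'$ for all composable $h,k,k'$; $f\perp g\Rightarrow\overline{f}\perp\overline{g}$.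 A $\perp$-restriction category is a restriction category with restriction zeroes and a chosen interference relation $\perp$. The $\perp$-join (written with $\sqcup$) of a family of parallel pairwise $\perp$-disjoint maps is their least upper bound for $\le$, if it exists. $\mathbb{X}$ has all binary $\perp$-joins if $f\sqcup g$ exists for all parallel $f\perp g$ and $h(f\sqcup g)=hf\sqcup hg$ for all composable $h$. A Kleene wand $\circledast$ on a $\perp$-restriction category with all binary $\perp$-joins assigns to each $f:X\to X$, $g:X\to A$ with $f\perp g$ a map $f\circledast g:X\to A$ such that: (1) if $f \perp g$, then $g\sqcup f(f\circledast g)=f\circledast g$; (2) $(f\circledast g)h=f\circledast gh$ for $f\perp g$, $h:A\to B$; (3) for $f:X\to Y$, $g:X\to A$, $k:Y\to X$ with $f\perp g$: $kf\circledast kg=k(fk\circledast g)$; (4) for $f,f':X\to X$, $g:X\to A$ with $f\perp f'$ and $f\sqcup f'\perp g$: $(f\circledast f')\perp(f\circledast g)$ and $(f\sqcup f')\circledast g=(f\circledast f')\circledast(f\circledast g)$. A $\perp$-itegory is a $\perp$-restriction category with all binary $\perp$-joins and a Kleene wand. *)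

theory Defs
  imports Main
begin

(* Composition is diagrammatic: in f \<Zcomp> g the map f comes first. *)

record ('o, 'm) cat_data =
  Obj :: "'o set"
  Arr :: "'m set"
  Dom :: "'m \<Rightarrow> 'o"
  Cod :: "'m \<Rightarrow> 'o"
  Id :: "'o \<Rightarrow> 'm"
  Comp :: "'m \<Rightarrow> 'm \<Rightarrow> 'm"  (infixl "\<Zcomp>\<index>" 70)

definition hom :: "('o, 'm, 'x) cat_data_scheme \<Rightarrow> 'o \<Rightarrow> 'o \<Rightarrow> 'm set" where
  "hom C A B = {f \<in> Arr C. Dom C f = A \<and> Cod C f = B}"

primrec mpow :: "('o, 'm, 'x) cat_data_scheme \<Rightarrow> 'm \<Rightarrow> nat \<Rightarrow> 'm" where
  "mpow C f 0 = Id C (Dom C f)"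
| "mpow C f (Suc n) = f \<Zcomp>\<^bsub>C\<^esub> mpow C f n"

locale category =
  fixes C :: "('o, 'm, 'x) cat_data_scheme" (structure)
  assumes Dom_Obj: "f \<in> Arr C \<Longrightarrow> Dom C f \<in> Obj C"
    and Cod_Obj: "f \<in> Arr C \<Longrightarrow> Cod C f \<in> Obj C"
    and Id_hom: "A \<in> Obj C \<Longrightarrow> Id C A \<in> hom C A A"
    and Comp_hom: "f \<in> hom C A B \<Longrightarrow> g \<in> hom C B D \<Longrightarrow> f \<Zcomp> g \<in> hom C A D"
    and Id_Comp: "f \<in> hom C A B \<Longrightarrow> Id C A \<Zcomp> f = f"
    and Comp_Id: "f \<in> hom C A B \<Longrightarrow> f \<Zcomp> Id C B = f"
    and Comp_assoc: "f \<in> hom C A B \<Longrightarrow> g \<in> hom C B D \<Longrightarrow> h \<in> hom C D E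
      \<Longrightarrow> (f \<Zcomp> g) \<Zcomp> h = f \<Zcomp> (g \<Zcomp> h)"

record ('o, 'm) rcat_data = "('o, 'm) cat_data" +
  Rst :: "'m \<Rightarrow> 'm"

locale restriction_category = category C
  for C :: "('o, 'm, 'x) rcat_data_scheme" (structure) +
  assumes Rst_hom: "f \<in> hom C A B \<Longrightarrow> Rst C f \<in> hom C A A"
    and Rst_Comp: "f \<in> hom C A B \<Longrightarrow> Rst C f \<Zcomp> f = f"
    and Rst_commute: "f \<in> hom C A B \<Longrightarrow> g \<in> hom C A D
      \<Longrightarrow> Rst C f \<Zcomp> Rst C g = Rst C g \<Zcomp> Rst C f"
    and Rst_Rst_Comp: "f \<in> hom C A B \<Longrightarrow> g \<in> hom C A D
      \<Longrightarrow> Rst C (Rst C g \<Zcomp> f) = Rst C g \<Zcomp> Rst C f"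
    and Comp_Rst: "f \<in> hom C A B \<Longrightarrow> g \<in> hom C B D
      \<Longrightarrow> f \<Zcomp> Rst C g = Rst C (f \<Zcomp> g) \<Zcomp> f"

definition rle :: "('o, 'm, 'x) rcat_data_scheme \<Rightarrow> 'm \<Rightarrow> 'm \<Rightarrow> bool"
    ("(_ \<preceq>\<index> _)" [51, 51] 50) where
  "f \<preceq>\<^bsub>C\<^esub> g \<longleftrightarrow>
     (\<exists>A B. f \<in> hom C A B \<and> g \<in> hom C A B \<and> Rst C f \<Zcomp>\<^bsub>C\<^esub> g = f)"

record ('o, 'm) pcat_data = "('o, 'm) rcat_data" +
  Zero :: "'o \<Rightarrow> 'o \<Rightarrow> 'm"
  Perp :: "'m \<Rightarrow> 'm \<Rightarrow> bool"  (infix "\<bottom>\<index>" 50)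

locale restriction_zero_category = restriction_category C
  for C :: "('o, 'm, 'x) pcat_data_scheme" (structure) +
  assumes Zero_hom: "A \<in> Obj C \<Longrightarrow> B \<in> Obj C \<Longrightarrow> Zero C A B \<in> hom C A B"
    and Comp_Zero: "f \<in> hom C A B \<Longrightarrow> D \<in> Obj C \<Longrightarrow> f \<Zcomp> Zero C B D = Zero C A D"
    and Zero_Comp: "f \<in> hom C A B \<Longrightarrow> D \<in> Obj C \<Longrightarrow> Zero C D A \<Zcomp> f = Zero C D B"
    and Rst_Zero: "A \<in> Obj C \<Longrightarrow> B \<in> Obj C \<Longrightarrow> Rst C (Zero C A B) = Zero C A A"

locale perp_restriction_category = restriction_zero_category C
  for C :: "('o, 'm, 'x) pcat_data_scheme" (structure) +
  assumes Perp_Arr: "f \<bottom> g \<Longrightarrow> f \<in> Arr C \<and> g \<in> Arr C \<and> Dom C f = Dom C g"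
    and Perp_Id_Zero: "A \<in> Obj C \<Longrightarrow> B \<in> Obj C \<Longrightarrow> Id C A \<bottom> Zero C A B"
    and Perp_sym: "f \<bottom> g \<Longrightarrow> g \<bottom> f"
    and Perp_self: "f \<bottom> f \<Longrightarrow> f = Zero C (Dom C f) (Cod C f)"
    and Perp_down: "f' \<bottom> g' \<Longrightarrow> f \<preceq> f' \<Longrightarrow> g \<preceq> g' \<Longrightarrow> f \<bottom> g"
    and Perp_Comp: "f \<bottom> g \<Longrightarrow> f \<in> hom C X A \<Longrightarrow> g \<in> hom C X B \<Longrightarrow> h \<in> hom C W X
      \<Longrightarrow> k \<in> hom C A A' \<Longrightarrow> k' \<in> hom C B B' \<Longrightarrow> h \<Zcomp> f \<Zcomp> k \<bottom> h \<Zcomp> g \<Zcomp> k'"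
    and Perp_Rst: "f \<bottom> g \<Longrightarrow> Rst C f \<bottom> Rst C g"

(* The hom-set is an explicit argument so that the empty family is covered. Disjointness is
   demanded of different indices, so a map occurring twice in the family must be zero. *)
definition is_perp_join ::
    "('o, 'm, 'x) pcat_data_scheme \<Rightarrow> 'o \<Rightarrow> 'o \<Rightarrow> 'i set \<Rightarrow> ('i \<Rightarrow> 'm) \<Rightarrow> 'm \<Rightarrow> bool" where
  "is_perp_join C A B I F j \<longleftrightarrow>
     (\<forall>i\<in>I. F i \<in> hom C A B) \<and>
     (\<forall>i\<in>I. \<forall>i'\<in>I. i \<noteq> i' \<longrightarrow> F i \<bottom>\<^bsub>C\<^esub> F i') \<and>
     j \<in> hom C A B \<and>
     (\<forall>i\<in>I. F i \<preceq>\<^bsub>C\<^esub> j) \<and>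
     (\<forall>u\<in>hom C A B. (\<forall>i\<in>I. F i \<preceq>\<^bsub>C\<^esub> u) \<longrightarrow> j \<preceq>\<^bsub>C\<^esub> u)"

definition is_binary_join :: "('o, 'm, 'x) pcat_data_scheme \<Rightarrow> 'm \<Rightarrow> 'm \<Rightarrow> 'm \<Rightarrow> bool" where
  "is_binary_join C f g j \<longleftrightarrow>
     is_perp_join C (Dom C f) (Cod C f) UNIV (\<lambda>b::bool. if b then f else g) j"

definition binary_join :: "('o, 'm, 'x) pcat_data_scheme \<Rightarrow> 'm \<Rightarrow> 'm \<Rightarrow> 'm"
    (infixl "\<squnion>\<index>" 65) where
  "f \<squnion>\<^bsub>C\<^esub> g = (THE j. is_binary_join C f g j)"

lemma (in restriction_category) rle_antisym:
  assumes "f \<preceq> g" "g \<preceq> f"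
  shows "f = g"
proof -
  obtain A B where h: "f \<in> hom C A B" "g \<in> hom C A B" and fg: "Rst C f \<Zcomp> g = f"
    using assms(1) unfolding rle_def by blast
  have gf: "Rst C g \<Zcomp> f = g"
    using assms(2) unfolding rle_def by blast
  note r = Rst_hom[OF h(1)] Rst_hom[OF h(2)]
  have "f = Rst C f \<Zcomp> (Rst C g \<Zcomp> f)"
    using fg gf by simp
  also have "\<dots> = Rst C g \<Zcomp> (Rst C f \<Zcomp> f)"
    using Comp_assoc[OF r h(1)] Comp_assoc[OF r(2,1) h(1)] Rst_commute[OF h] by simp
  also have "\<dots> = g"
    using Rst_Comp[OF h(1)] gf by simp
  finally show ?thesis .
qed

lemma is_perp_join_unique:
  assumes "restriction_category C" "is_perp_join C A B I F j" "is_perp_join C A B I F j'"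
  shows "j = j'"
  using assms restriction_category.rle_antisym[of C j j'] unfolding is_perp_join_def by blast

locale binary_perp_joins = perp_restriction_category C
  for C :: "('o, 'm, 'x) pcat_data_scheme" (structure) +
  assumes binary_join_exists:
      "f \<in> hom C A B \<Longrightarrow> g \<in> hom C A B \<Longrightarrow> f \<bottom> g \<Longrightarrow> \<exists>j. is_binary_join C f g j"
    and Comp_binary_join: "f \<in> hom C A B \<Longrightarrow> g \<in> hom C A B \<Longrightarrow> f \<bottom> g \<Longrightarrow> h \<in> hom C W A
      \<Longrightarrow> h \<Zcomp> (f \<squnion> g) = (h \<Zcomp> f) \<squnion> (h \<Zcomp> g)"

locale perp_itegory = binary_perp_joins C
  for C :: "('o, 'm, 'x) pcat_data_scheme" (structure) +
  fixes wand :: "'m \<Rightarrow> 'm \<Rightarrow> 'm"  (infixl "\<circledast>" 60)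
  assumes wand_hom:
      "f \<in> hom C X X \<Longrightarrow> g \<in> hom C X A \<Longrightarrow> f \<bottom> g \<Longrightarrow> f \<circledast> g \<in> hom C X A"
    and wand_unfold: "f \<in> hom C X X \<Longrightarrow> g \<in> hom C X A \<Longrightarrow> f \<bottom> g
      \<Longrightarrow> g \<squnion> (f \<Zcomp> (f \<circledast> g)) = f \<circledast> g"
    and wand_natural: "f \<in> hom C X X \<Longrightarrow> g \<in> hom C X A \<Longrightarrow> f \<bottom> g \<Longrightarrow> h \<in> hom C A B
      \<Longrightarrow> (f \<circledast> g) \<Zcomp> h = f \<circledast> (g \<Zcomp> h)"
    and wand_dinatural: "f \<in> hom C X Y \<Longrightarrow> g \<in> hom C X A \<Longrightarrow> k \<in> hom C Y X \<Longrightarrow> f \<bottom> g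
      \<Longrightarrow> (k \<Zcomp> f) \<circledast> (k \<Zcomp> g) = k \<Zcomp> ((f \<Zcomp> k) \<circledast> g)"
    and wand_diagonal_Perp: "f \<in> hom C X X \<Longrightarrow> f' \<in> hom C X X \<Longrightarrow> g \<in> hom C X A
      \<Longrightarrow> f \<bottom> f' \<Longrightarrow> f \<squnion> f' \<bottom> g \<Longrightarrow> (f \<circledast> f') \<bottom> (f \<circledast> g)"
    and wand_diagonal: "f \<in> hom C X X \<Longrightarrow> f' \<in> hom C X X \<Longrightarrow> g \<in> hom C X A
      \<Longrightarrow> f \<bottom> f' \<Longrightarrow> f \<squnion> f' \<bottom> g
      \<Longrightarrow> (f \<squnion> f') \<circledast> g = (f \<circledast> f') \<circledast> (f \<circledast> g)"

end

theory Submission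
  imports Defs
begin

text \<open>For \<open>n < m\<close> both \<open>f\<^sup>n g\<close> and \<open>f\<^sup>m h\<close> factor through \<open>f\<^sup>n\<close>, followed by \<open>g\<close> and by \<open>f\<close>
  respectively, so disjointness reduces to \<open>f \<bottom> g\<close>. Composing the unfolding law of the wand
  \<open>w = f \<circledast> g\<close> with \<open>f\<^sup>n\<close> exhibits \<open>f\<^sup>n w\<close> as the binary join of \<open>f\<^sup>n g\<close> and \<open>f\<^bsup>n+1\<^esup> w\<close>, and
  telescoping these joins gives both the upper and the least bound property.\<close>

lemma (in category) mpow_hom:
  assumes "f \<in> hom C X X"
  shows "mpow C f n \<in> hom C X X"
proof (induction n)
  case 0
  have "X \<in> Obj C" "Dom C f = X"
    using assms Dom_Obj unfolding hom_def by auto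
  then show ?case
    using Id_hom by simp
next
  case (Suc n)
  then show ?case
    using Comp_hom[OF assms] by simp
qed

lemma (in category) mpow_0_Comp:
  assumes "f \<in> hom C X X" "h \<in> hom C X B"
  shows "mpow C f 0 \<Zcomp> h = h"
  using assms(1) Id_Comp[OF assms(2)] unfolding hom_def by simp

lemma (in category) mpow_add_Comp:
  assumes f: "f \<in> hom C X X" and h: "h \<in> hom C X B"
  shows "mpow C f (n + m) \<Zcomp> h = mpow C f n \<Zcomp> (mpow C f m \<Zcomp> h)"
proof (induction n)
  case 0
  then show ?case
    using mpow_0_Comp[OF f Comp_hom[OF mpow_hom[OF f] h]] by simp
next
  case (Suc n)
  then show ?case
    using Comp_assoc[OF f mpow_hom[OF f] h]
      Comp_assoc[OF f mpow_hom[OF f] Comp_hom[OF mpow_hom[OF f] h]]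
    by simp
qed

lemma (in category) mpow_1_Comp:
  assumes f: "f \<in> hom C X X" and h: "h \<in> hom C X B"
  shows "mpow C f (Suc 0) \<Zcomp> h = f \<Zcomp> h"
  using Comp_assoc[OF f mpow_hom[OF f, of 0] h] mpow_0_Comp[OF f h] by simp

lemma (in restriction_category) rle_refl:
  assumes "f \<in> hom C A B"
  shows "f \<preceq> f"
  using assms Rst_Comp unfolding rle_def by blast

lemma (in restriction_category) rle_trans:
  assumes "f \<preceq> g" "g \<preceq> h"
  shows "f \<preceq> h"
proof -
  obtain A B where fg: "f \<in> hom C A B" "g \<in> hom C A B" "Rst C f \<Zcomp> g = f"
    using assms(1) unfolding rle_def by blast
  have h: "h \<in> hom C A B" "Rst C g \<Zcomp> h = g"
    using assms(2) fg(2) unfolding rle_def hom_def by auto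
  \<comment> \<open>As \<open>f\<close> equals \<open>Rst C f\<close> followed by \<open>g\<close>,
    its restriction is the product of \<open>Rst C f\<close> and \<open>Rst C g\<close>; the second
    factor then turns \<open>h\<close> into \<open>g\<close>.\<close>
  have "Rst C f \<Zcomp> h = (Rst C f \<Zcomp> Rst C g) \<Zcomp> h"
    using Rst_Rst_Comp[OF fg(2,1)] fg(3) by simp
  also have "\<dots> = f"
    using Comp_assoc[OF Rst_hom[OF fg(1)] Rst_hom[OF fg(2)] h(1)] h(2) fg(3) by simp
  finally show ?thesis
    using fg(1) h(1) unfolding rle_def by blast
qed

text \<open>With \<open>h\<close> arbitrary, one statement serves two uses: \<open>h = g\<close> for
  pairs of powers, and \<open>h\<close> the wand for a power against the remainder.\<close>

lemma (in perp_restriction_category) mpow_Comp_Perp: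
  assumes f: "f \<in> hom C X X" and g: "g \<in> hom C X A" and fg: "f \<bottom> g"
    and h: "h \<in> hom C X B" and "n < m"
  shows "mpow C f n \<Zcomp> g \<bottom> mpow C f m \<Zcomp> h"
proof -
  \<comment> \<open>Strictness of \<open>n < m\<close> leaves at least one \<open>f\<close> after
    the common prefix \<open>mpow C f n\<close>; this is the copy that meets
    \<open>g\<close>.\<close>
  obtain k where m: "m = n + Suc k"
    using \<open>n < m\<close> less_iff_Suc_add by auto
  let ?p = "mpow C f n" and ?q = "mpow C f k \<Zcomp> h"
  have p: "?p \<in> hom C X X" and q: "?q \<in> hom C X B"
    using mpow_hom[OF f] Comp_hom[OF mpow_hom[OF f] h] by auto
  have A: "Id C A \<in> hom C A A"
    using g Cod_Obj Id_hom unfolding hom_def by auto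
  have "?p \<Zcomp> g \<Zcomp> Id C A \<bottom> ?p \<Zcomp> f \<Zcomp> ?q"
    using Perp_Comp[OF Perp_sym[OF fg] g f p A q] .
  moreover have "?p \<Zcomp> g \<Zcomp> Id C A = ?p \<Zcomp> g"
    using Comp_Id[OF Comp_hom[OF p g]] .
  moreover have "mpow C f m \<Zcomp> h = ?p \<Zcomp> f \<Zcomp> ?q"
    using mpow_add_Comp[OF f h, of n "Suc k"] Comp_assoc[OF f mpow_hom[OF f] h]
      Comp_assoc[OF p f q] m by simp
  ultimately show ?thesis
    by simp
qed

lemma (in perp_restriction_category) mpow_Comp_Perp_neq:
  assumes "f \<in> hom C X X" "g \<in> hom C X A" "f \<bottom> g" "n \<noteq> m"
  shows "mpow C f n \<Zcomp> g \<bottom> mpow C f m \<Zcomp> g"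
  using mpow_Comp_Perp[OF assms(1-3,2)] Perp_sym assms(4) by (metis linorder_neqE_nat)

text \<open>Existence is assumed and antisymmetry gives uniqueness, so the definite description
  denotes an actual join.\<close>

lemma (in binary_perp_joins) is_binary_join_binary_join:
  assumes "f \<in> hom C A B" "g \<in> hom C A B" "f \<bottom> g"
  shows "is_binary_join C f g (f \<squnion> g)"
proof -
  obtain j where j: "is_binary_join C f g j"
    using binary_join_exists[OF assms] by blast
  have "j' = j" if "is_binary_join C f g j'" for j'
    using that j is_perp_join_unique[OF restriction_category_axioms]
    unfolding is_binary_join_def by blast
  then show ?thesis
    unfolding binary_join_def using theI[of "is_binary_join C f g", OF j] by blast
qed

lemma (in binary_perp_joins)
  assumes "f \<in> hom C A B" "g \<in> hom C A B" "f \<bottom> g"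
  shows binary_join_ge1: "f \<preceq> f \<squnion> g"
    and binary_join_ge2: "g \<preceq> f \<squnion> g"
    and binary_join_least: "f \<preceq> u \<Longrightarrow> g \<preceq> u \<Longrightarrow> f \<squnion> g \<preceq> u"
proof -
  have j: "is_perp_join C A B UNIV (\<lambda>b::bool. if b then f else g) (f \<squnion> g)"
    using is_binary_join_binary_join[OF assms] assms(1)
    unfolding is_binary_join_def hom_def by auto
  show "f \<preceq> f \<squnion> g" "g \<preceq> f \<squnion> g"
    using j unfolding is_perp_join_def by (metis UNIV_I)+
  assume u: "f \<preceq> u" "g \<preceq> u"
  then have "u \<in> hom C A B"
    using assms(1) unfolding rle_def hom_def by auto
  with j u show "f \<squnion> g \<preceq> u"
    unfolding is_perp_join_def by simp
qed

context perp_itegory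
begin

context
  fixes f g X A
  assumes f: "f \<in> hom C X X" and g: "g \<in> hom C X A" and fg: "f \<bottom> g"
begin

lemma mpow_Comp_wand_hom: "mpow C f n \<Zcomp> (f \<circledast> g) \<in> hom C X A"
  using Comp_hom[OF mpow_hom[OF f] wand_hom[OF f g fg]] .

lemma mpow_Comp_wand_unfold:
  "mpow C f n \<Zcomp> (f \<circledast> g) = (mpow C f n \<Zcomp> g) \<squnion> (mpow C f (Suc n) \<Zcomp> (f \<circledast> g))"
proof -
  note w = wand_hom[OF f g fg]
  \<comment> \<open>These are the exponents 0 and 1 of the general disjointness.\<close>
  have "g \<bottom> f \<Zcomp> (f \<circledast> g)"
    using mpow_Comp_Perp[OF f g fg w, of 0 "Suc 0"]
    by (simp only: mpow_0_Comp[OF f g] mpow_1_Comp[OF f w])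
  then have "mpow C f n \<Zcomp> (g \<squnion> (f \<Zcomp> (f \<circledast> g)))
      = (mpow C f n \<Zcomp> g) \<squnion> (mpow C f n \<Zcomp> (f \<Zcomp> (f \<circledast> g)))"
    using Comp_binary_join[OF g Comp_hom[OF f w] _ mpow_hom[OF f]] by blast
  \<comment> \<open>\<open>mpow\<close> adds factors on the left, whereas here the new
    \<open>f\<close> stands on the right of the power.\<close>
  moreover have "mpow C f n \<Zcomp> (f \<Zcomp> (f \<circledast> g)) = mpow C f (Suc n) \<Zcomp> (f \<circledast> g)"
    using mpow_add_Comp[OF f w, of n "Suc 0"] mpow_1_Comp[OF f w] by simp
  ultimately show ?thesis
    using wand_unfold[OF f g fg] by simp
qed

text \<open>The three premises of the binary join facts, for the two components of the unfolded
  \<open>n\<close>-th tail.\<close>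

lemmas mpow_Comp_wand_join =
  Comp_hom[OF mpow_hom[OF f] g] mpow_Comp_wand_hom
  mpow_Comp_Perp[OF f g fg wand_hom[OF f g fg] lessI]

text \<open>The tails form a descending chain from \<open>f \<circledast> g\<close>, each being the
  second component of the join that equals its predecessor.\<close>

lemma mpow_Comp_wand_rle: "mpow C f n \<Zcomp> (f \<circledast> g) \<preceq> f \<circledast> g"
proof (induction n)
  case 0
  note w = wand_hom[OF f g fg]
  show ?case
    using rle_refl[OF w] mpow_0_Comp[OF f w] by simp
next
  case (Suc n)
  have "mpow C f (Suc n) \<Zcomp> (f \<circledast> g) \<preceq> mpow C f n \<Zcomp> (f \<circledast> g)"
    unfolding mpow_Comp_wand_unfold[of n] by (rule binary_join_ge2[OF mpow_Comp_wand_join])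
  then show ?case
    using rle_trans Suc.IH by blast
qed

lemma mpow_Comp_rle_wand: "mpow C f n \<Zcomp> g \<preceq> f \<circledast> g"
proof -
  have "mpow C f n \<Zcomp> g \<preceq> mpow C f n \<Zcomp> (f \<circledast> g)"
    unfolding mpow_Comp_wand_unfold[of n] by (rule binary_join_ge1[OF mpow_Comp_wand_join])
  then show ?thesis
    using rle_trans mpow_Comp_wand_rle by blast
qed

text \<open>Induction folds the tail back: bounds on the last power and on the tail after it bound
  the tail one step earlier, down to exponent 0.\<close>

lemma wand_least:
  assumes "\<And>i. i < n \<Longrightarrow> mpow C f i \<Zcomp> g \<preceq> u" and "mpow C f n \<Zcomp> (f \<circledast> g) \<preceq> u"
  shows "f \<circledast> g \<preceq> u"
  using assms
proof (induction n)
  case 0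
  then show ?case
    using mpow_0_Comp[OF f wand_hom[OF f g fg]] by simp
next
  case (Suc n)
  have "mpow C f n \<Zcomp> (f \<circledast> g) \<preceq> u"
    unfolding mpow_Comp_wand_unfold[of n]
    using Suc.prems by (intro binary_join_least[OF mpow_Comp_wand_join]) auto
  then show ?case
    using Suc.IH Suc.prems(1) by simp
qed

text \<open>Indices up to \<open>n\<close> carry the powers and the extra index \<open>Suc n\<close>
  carries the remainder, so the family has \<open>n + 2\<close> members.\<close>

lemma is_perp_join_wand:
  "is_perp_join C X A {..Suc n}
    (\<lambda>i. if i \<le> n then mpow C f i \<Zcomp> g else mpow C f (Suc n) \<Zcomp> (f \<circledast> g)) (f \<circledast> g)"
  (is "is_perp_join C X A _ ?F _")
  unfolding is_perp_join_def
proof (intro conjI ballI impI)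
  fix i show "?F i \<in> hom C X A"
    \<comment> \<open>\<open>mpow C f (Suc n)\<close> must stay folded to match the cited
      facts.\<close>
    using Comp_hom[OF mpow_hom[OF f] g] mpow_Comp_wand_hom[of "Suc n"] by (simp del: mpow.simps)
  show "?F i \<preceq> f \<circledast> g"
    using mpow_Comp_rle_wand mpow_Comp_wand_rle[of "Suc n"] by (simp del: mpow.simps)
next
  fix i i' assume "i \<in> {..Suc n}" "i' \<in> {..Suc n}" "i \<noteq> i'"
  \<comment> \<open>Pairs that involve the remainder; two distinct powers are covered by
    \<open>mpow_Comp_Perp_neq\<close>.\<close>
  moreover have "mpow C f k \<Zcomp> g \<bottom> mpow C f (Suc n) \<Zcomp> (f \<circledast> g)" if "k \<le> n" for k
    using mpow_Comp_Perp[OF f g fg wand_hom[OF f g fg]] that by (simp del: mpow.simps)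
  ultimately show "?F i \<bottom> ?F i'"
    using mpow_Comp_Perp_neq[OF f g fg] Perp_sym by (auto simp del: mpow.simps)
next
  show "f \<circledast> g \<in> hom C X A"
    using wand_hom[OF f g fg] .
next
  fix u assume "\<forall>i\<in>{..Suc n}. ?F i \<preceq> u"
  then have u: "?F i \<preceq> u" if "i \<le> Suc n" for i
    using that by blast
  show "f \<circledast> g \<preceq> u"
  proof (rule wand_least)
    show "mpow C f i \<Zcomp> g \<preceq> u" if "i < Suc n" for i
      using u[of i] that by simp
    show "mpow C f (Suc n) \<Zcomp> (f \<circledast> g) \<preceq> u"
      using u[of "Suc n"] by simp
  qed
qed

end

end

theorem lemma5p3:
  fixes C :: "('o, 'm, 'x) pcat_data_scheme" and X A :: 'o and f g :: 'm
  assumes "perp_restriction_category C"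
    and "f \<in> hom C X X" and "g \<in> hom C X A" and "f \<bottom>\<^bsub>C\<^esub> g"
  shows "(\<forall>n m. n \<noteq> m \<longrightarrow> mpow C f n \<Zcomp>\<^bsub>C\<^esub> g \<bottom>\<^bsub>C\<^esub> mpow C f m \<Zcomp>\<^bsub>C\<^esub> g) \<and>
    (\<forall>wand. perp_itegory C wand \<longrightarrow>
      (\<forall>n. is_perp_join C X A {..Suc n}
        (\<lambda>i. if i \<le> n then mpow C f i \<Zcomp>\<^bsub>C\<^esub> g else mpow C f (Suc n) \<Zcomp>\<^bsub>C\<^esub> wand f g)
        (wand f g)) \<and>
      (\<forall>n. mpow C f n \<Zcomp>\<^bsub>C\<^esub> g \<preceq>\<^bsub>C\<^esub> wand f g))"
  using perp_restriction_category.mpow_Comp_Perp_neq[OF assms]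
    perp_itegory.is_perp_join_wand[OF _ assms(2-4)]
    perp_itegory.mpow_Comp_rle_wand[OF _ assms(2-4)]
  by blast

end
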